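(* Let $\varepsilon\in\{1,-1\}$ and let $M$ be an $n$-dimensional submanifold of codimension $r$ in a Riemannian manifold $(\widetilde M,\widetilde g)$ equipped with a $(1,1)$-tensor field $\widetilde P$ such that $\widetilde P^2=\varepsilon I$ and $\widetilde g(\widetilde PU,\widetilde PV)=\widetilde g(U,V)$ for all vector fields $U,V$ on $\widetilde M$. Then the structure $(P,g,u_\alpha,\varepsilon\xi_\alpha,(a_{\alpha\beta})_r)$ induced on $M$ satisfies, for all $X,Y\in\chi(M)$ and all $\alpha,\beta\in\{1,\dots,r\}$: (1) $P^2X=\varepsilon\bigl(X-\sum_\alpha u_\alpha(X)\xi_\alpha\bigr)$; (2) $u_\alpha(PX)=-\sum_\beta a_{\beta\alpha}u_\beta(X)$; (3) $a_{\alpha\beta}=\varepsilon a_{\beta\alpha}$; (4) $u_\alpha(\xi_\beta)=g(\xi_\alpha,\xi_\beta)=\delta_{\alpha\beta}-\varepsilon\sum_\gamma a_{\alpha\gamma}a_{\gamma\beta}$; (5) $P\xi_\alpha=-\sum_\beta a_{\alpha\beta}\xi_\beta$; (6) $u_\alpha(X)=g(X,\xi_\alpha)$; (7) $g(PX,Y)=\varepsilon g(X,PY)$; (8) $g(PX,PY)=g(X,Y)-\sum_\alpha u_\alpha(X)u_\alpha(Y)$.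
   Context: $g$ is the metric induced on $M$ by $\widetilde g$; $\chi(M)$ denotes the vector fields on $M$; $(N_1,\dots,N_r)$ is a smooth orthonormal frame of the normal bundle of $M$. The induced structure is defined by the decompositions into components tangent and normal to $M$: $$\widetilde P X=PX+\sum_{\alpha}u_\alpha(X)N_\alpha\ (X\in\chi(M)),\qquad \widetilde P N_\alpha=\varepsilon\xi_\alpha+\sum_\beta a_{\alpha\beta}N_\beta,$$ where $P$ is a $(1,1)$-tensor field on $M$, $u_\alpha$ are 1-forms on $M$, $\xi_\alpha$ are tangent vector fields on $M$ and $a_{\alpha\beta}$ are real functions on $M$. *)

theory Defs
  imports "HOL-Analysis.Analysis" "HOL-Library.Function_Algebras"
begin

instantiation "fun" :: (type, real_vector) real_vector
begin

definition scaleR_fun_def: "a *\<^sub>R f = (\<lambda>x. a *\<^sub>R f x)"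

instance
  by standard (auto simp: scaleR_fun_def fun_eq_iff scaleR_add_right scaleR_add_left)

end

lemma scaleR_fun_apply [simp]: "(a *\<^sub>R f) x = a *\<^sub>R f x"
  by (simp add: scaleR_fun_def)

definition linear_within :: "'v::real_vector set \<Rightarrow> ('v \<Rightarrow> 'w::real_vector) \<Rightarrow> bool" where
  "linear_within V f \<longleftrightarrow>
     (\<forall>v\<in>V. \<forall>w\<in>V. f (v + w) = f v + f w) \<and> (\<forall>a. \<forall>v\<in>V. f (a *\<^sub>R v) = a *\<^sub>R f v)"


section \<open>Smooth functions on open subsets of Euclidean spaces\<close>

text \<open>Both notions are only used for open \<open>S\<close>.\<close>

primrec ck_on :: "nat \<Rightarrow> 'a::euclidean_space set \<Rightarrow> ('a \<Rightarrow> 'b::real_normed_vector) \<Rightarrow> bool" where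
  "ck_on 0 = (\<lambda>S f. continuous_on S f)"
| "ck_on (Suc k) = (\<lambda>S f. (\<forall>x\<in>S. f differentiable (at x)) \<and>
     (\<forall>v. ck_on k S (\<lambda>x. frechet_derivative f (at x) v)))"

definition smooth_on :: "'a::euclidean_space set \<Rightarrow> ('a \<Rightarrow> 'b::real_normed_vector) \<Rightarrow> bool" where
  "smooth_on S f \<longleftrightarrow> (\<forall>k. ck_on k S f)"


section \<open>Smooth manifolds\<close>

text \<open>A chart is its domain together with its coordinate map; the values of the coordinate map
  off the domain are irrelevant.\<close>

type_synonym ('p, 'e) chart = "'p set \<times> ('p \<Rightarrow> 'e)"

abbreviation cdom :: "('p, 'e) chart \<Rightarrow> 'p set" where "cdom \<equiv> fst"
abbreviation cmap :: "('p, 'e) chart \<Rightarrow> 'p \<Rightarrow> 'e" where "cmap \<equiv> snd"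

definition cinv :: "('p, 'e) chart \<Rightarrow> 'e \<Rightarrow> 'p" where
  "cinv c = inv_into (cdom c) (cmap c)"

record ('p, 'e) manifold =
  mtop :: "'p topology"
  atlas :: "('p, 'e) chart set"

abbreviation points :: "('p, 'e) manifold \<Rightarrow> 'p set" where
  "points M \<equiv> topspace (mtop M)"

text \<open>The atlas is any smooth atlas; it need not be maximal.  The dimension is the dimension of
  the model space \<open>'e\<close>.\<close>

definition smooth_manifold :: "('p, 'e::euclidean_space) manifold \<Rightarrow> bool" where
  "smooth_manifold M \<longleftrightarrow>
     Hausdorff_space (mtop M) \<and> second_countable (mtop M) \<and>
     (\<Union>c\<in>atlas M. cdom c) = points M \<and>
     (\<forall>c\<in>atlas M. openin (mtop M) (cdom c) \<and> open (cmap c ` cdom c) \<and>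
        homeomorphic_map (subtopology (mtop M) (cdom c)) (top_of_set (cmap c ` cdom c)) (cmap c)) \<and>
     (\<forall>c\<in>atlas M. \<forall>d\<in>atlas M. smooth_on (cmap c ` (cdom c \<inter> cdom d)) (cmap d \<circ> cinv c))"


section \<open>Tangent vectors and tensor fields\<close>

text \<open>A tangent vector at \<open>p\<close> is the family of its coordinate vectors in all charts around \<open>p\<close>,
  related by the derivatives of the transition maps.  Entries at charts not containing \<open>p\<close> are
  0, so that vector operations are the pointwise ones of the function space.\<close>

type_synonym ('p, 'e) tvec = "('p, 'e) chart \<Rightarrow> 'e"

definition tangent_space :: "('p, 'e::euclidean_space) manifold \<Rightarrow> 'p \<Rightarrow> ('p, 'e) tvec set" where
  "tangent_space M p = {v.
     (\<forall>c. c \<notin> atlas M \<or> p \<notin> cdom c \<longrightarrow> v c = 0) \<and>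
     (\<forall>c\<in>atlas M. \<forall>d\<in>atlas M. p \<in> cdom c \<and> p \<in> cdom d \<longrightarrow>
        v d = frechet_derivative (cmap d \<circ> cinv c) (at (cmap c p)) (v c))}"

text \<open>\<open>coord_vec M c e p\<close> is the tangent vector at \<open>p\<close> whose coordinates in the chart \<open>c\<close> are
  \<open>e\<close>; for \<open>e\<close> in the standard basis it is a coordinate vector field of \<open>c\<close>.\<close>

definition coord_vec ::
    "('p, 'e::euclidean_space) manifold \<Rightarrow> ('p, 'e) chart \<Rightarrow> 'e \<Rightarrow> 'p \<Rightarrow> ('p, 'e) tvec" where
  "coord_vec M c e p = (\<lambda>d. if d \<in> atlas M \<and> p \<in> cdom d
     then frechet_derivative (cmap d \<circ> cinv c) (at (cmap c p)) e else 0)"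

definition vector_fields :: "('p, 'e::euclidean_space) manifold \<Rightarrow> ('p \<Rightarrow> ('p, 'e) tvec) set" where
  "vector_fields M = {X.
     (\<forall>p\<in>points M. X p \<in> tangent_space M p) \<and>
     (\<forall>c\<in>atlas M. smooth_on (cmap c ` cdom c) (\<lambda>x. X (cinv c x) c))}"

definition one_form ::
    "('p, 'e::euclidean_space) manifold \<Rightarrow> ('p \<Rightarrow> ('p, 'e) tvec \<Rightarrow> real) \<Rightarrow> bool" where
  "one_form M u \<longleftrightarrow>
     (\<forall>p\<in>points M. linear_within (tangent_space M p) (u p)) \<and>
     (\<forall>c\<in>atlas M. \<forall>e\<in>Basis.
        smooth_on (cmap c ` cdom c) (\<lambda>x. u (cinv c x) (coord_vec M c e (cinv c x))))"

definition tensor_field_11 ::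
    "('p, 'e::euclidean_space) manifold \<Rightarrow> ('p \<Rightarrow> ('p, 'e) tvec \<Rightarrow> ('p, 'e) tvec) \<Rightarrow> bool" where
  "tensor_field_11 M P \<longleftrightarrow>
     (\<forall>p\<in>points M. (\<forall>v\<in>tangent_space M p. P p v \<in> tangent_space M p) \<and>
        linear_within (tangent_space M p) (P p)) \<and>
     (\<forall>c\<in>atlas M. \<forall>e\<in>Basis.
        smooth_on (cmap c ` cdom c) (\<lambda>x. P (cinv c x) (coord_vec M c e (cinv c x)) c))"

definition riemannian_metric ::
    "('p, 'e::euclidean_space) manifold \<Rightarrow> ('p \<Rightarrow> ('p, 'e) tvec \<Rightarrow> ('p, 'e) tvec \<Rightarrow> real) \<Rightarrow> bool" where
  "riemannian_metric M g \<longleftrightarrow>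
     (\<forall>p\<in>points M. \<forall>v\<in>tangent_space M p.
        linear_within (tangent_space M p) (g p v) \<and>
        (\<forall>w\<in>tangent_space M p. g p v w = g p w v) \<and>
        (v \<noteq> 0 \<longrightarrow> g p v v > 0)) \<and>
     (\<forall>c\<in>atlas M. \<forall>e\<in>Basis. \<forall>e'\<in>Basis. smooth_on (cmap c ` cdom c)
        (\<lambda>x. g (cinv c x) (coord_vec M c e (cinv c x)) (coord_vec M c e' (cinv c x))))"


section \<open>Submanifolds\<close>

definition smooth_map ::
    "('p, 'e::euclidean_space) manifold \<Rightarrow> ('q, 'f::euclidean_space) manifold \<Rightarrow> ('p \<Rightarrow> 'q) \<Rightarrow> bool" where
  "smooth_map M N f \<longleftrightarrow> continuous_map (mtop M) (mtop N) f \<and>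
     (\<forall>c\<in>atlas M. \<forall>d\<in>atlas N.
        smooth_on (cmap c ` {p \<in> cdom c. f p \<in> cdom d}) (cmap d \<circ> f \<circ> cinv c))"

text \<open>The chart of \<open>M\<close> used to compute the differential is chosen arbitrarily; for smooth \<open>f\<close> and
  tangent \<open>v\<close> the result does not depend on the choice.\<close>

definition differential ::
    "('p, 'e::euclidean_space) manifold \<Rightarrow> ('q, 'f::euclidean_space) manifold \<Rightarrow> ('p \<Rightarrow> 'q) \<Rightarrow>
     'p \<Rightarrow> ('p, 'e) tvec \<Rightarrow> ('q, 'f) tvec" where
  "differential M N f p v = (\<lambda>d. if d \<in> atlas N \<and> f p \<in> cdom d
     then (let c = (SOME c. c \<in> atlas M \<and> p \<in> cdom c)
           in frechet_derivative (cmap d \<circ> f \<circ> cinv c) (at (cmap c p)) (v c))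
     else 0)"

definition immersion ::
    "('p, 'e::euclidean_space) manifold \<Rightarrow> ('q, 'f::euclidean_space) manifold \<Rightarrow> ('p \<Rightarrow> 'q) \<Rightarrow> bool" where
  "immersion M N f \<longleftrightarrow> smooth_map M N f \<and>
     (\<forall>p\<in>points M. inj_on (differential M N f p) (tangent_space M p))"

definition induced_metric ::
    "('p, 'e::euclidean_space) manifold \<Rightarrow> ('q, 'f::euclidean_space) manifold \<Rightarrow> ('p \<Rightarrow> 'q) \<Rightarrow>
     ('q \<Rightarrow> ('q, 'f) tvec \<Rightarrow> ('q, 'f) tvec \<Rightarrow> real) \<Rightarrow> 'p \<Rightarrow> ('p, 'e) tvec \<Rightarrow> ('p, 'e) tvec \<Rightarrow> real" where
  "induced_metric M N f g p v w = g (f p) (differential M N f p v) (differential M N f p w)"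

definition normal_space ::
    "('p, 'e::euclidean_space) manifold \<Rightarrow> ('q, 'f::euclidean_space) manifold \<Rightarrow> ('p \<Rightarrow> 'q) \<Rightarrow>
     ('q \<Rightarrow> ('q, 'f) tvec \<Rightarrow> ('q, 'f) tvec \<Rightarrow> real) \<Rightarrow> 'p \<Rightarrow> ('q, 'f) tvec set" where
  "normal_space M N f g p = {w \<in> tangent_space N (f p).
     \<forall>v\<in>tangent_space M p. g (f p) (differential M N f p v) w = 0}"

definition normal_frame ::
    "('p, 'e::euclidean_space) manifold \<Rightarrow> ('q, 'f::euclidean_space) manifold \<Rightarrow> ('p \<Rightarrow> 'q) \<Rightarrow>
     ('q \<Rightarrow> ('q, 'f) tvec \<Rightarrow> ('q, 'f) tvec \<Rightarrow> real) \<Rightarrow> nat \<Rightarrow> (nat \<Rightarrow> 'p \<Rightarrow> ('q, 'f) tvec) \<Rightarrow> bool" where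
  "normal_frame M N f g r \<nu> \<longleftrightarrow>
     (\<forall>p\<in>points M. span ((\<lambda>\<alpha>. \<nu> \<alpha> p) ` {1..r}) = normal_space M N f g p \<and>
        (\<forall>\<alpha>\<in>{1..r}. \<forall>\<beta>\<in>{1..r}. g (f p) (\<nu> \<alpha> p) (\<nu> \<beta> p) = (if \<alpha> = \<beta> then 1 else 0))) \<and>
     (\<forall>\<alpha>\<in>{1..r}. \<forall>c\<in>atlas M. \<forall>d\<in>atlas N.
        smooth_on (cmap c ` {p \<in> cdom c. f p \<in> cdom d}) (\<lambda>x. \<nu> \<alpha> (cinv c x) d))"

text \<open>The structure \<open>(P, u\<^sub>\<alpha>, \<epsilon> \<xi>\<^sub>\<alpha>, a\<^sub>\<alpha>\<^sub>\<beta>)\<close> obtained by decomposing \<open>Pt X\<close>, for \<open>X\<close> tangent to \<open>M\<close>,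
  and \<open>Pt \<nu>\<^sub>\<alpha>\<close> into components tangent and normal to \<open>M\<close>, where \<open>f\<close> immerses \<open>M\<close> in \<open>N\<close> and vectors
  tangent to \<open>M\<close> are regarded as tangent to \<open>N\<close> through its differential.\<close>

definition induced_structure ::
    "('p, 'e::euclidean_space) manifold \<Rightarrow> ('q, 'f::euclidean_space) manifold \<Rightarrow> ('p \<Rightarrow> 'q) \<Rightarrow>
     ('q \<Rightarrow> ('q, 'f) tvec \<Rightarrow> ('q, 'f) tvec) \<Rightarrow> real \<Rightarrow> nat \<Rightarrow> (nat \<Rightarrow> 'p \<Rightarrow> ('q, 'f) tvec) \<Rightarrow>
     ('p \<Rightarrow> ('p, 'e) tvec \<Rightarrow> ('p, 'e) tvec) \<Rightarrow> (nat \<Rightarrow> 'p \<Rightarrow> ('p, 'e) tvec \<Rightarrow> real) \<Rightarrow>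
     (nat \<Rightarrow> 'p \<Rightarrow> ('p, 'e) tvec) \<Rightarrow> (nat \<Rightarrow> nat \<Rightarrow> 'p \<Rightarrow> real) \<Rightarrow> bool" where
  "induced_structure M N f Pt \<epsilon> r \<nu> P u \<xi> a \<longleftrightarrow>
     tensor_field_11 M P \<and>
     (\<forall>\<alpha>\<in>{1..r}. one_form M (u \<alpha>)) \<and>
     (\<forall>\<alpha>\<in>{1..r}. \<xi> \<alpha> \<in> vector_fields M) \<and>
     (\<forall>X\<in>vector_fields M. \<forall>p\<in>points M.
        Pt (f p) (differential M N f p (X p)) =
          differential M N f p (P p (X p)) + (\<Sum>\<alpha>=1..r. u \<alpha> p (X p) *\<^sub>R \<nu> \<alpha> p)) \<and>
     (\<forall>\<alpha>\<in>{1..r}. \<forall>p\<in>points M.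
        Pt (f p) (\<nu> \<alpha> p) =
          \<epsilon> *\<^sub>R differential M N f p (\<xi> \<alpha> p) + (\<Sum>\<beta>=1..r. a \<alpha> \<beta> p *\<^sub>R \<nu> \<beta> p))"

end

theory Submission
  imports Defs
begin

text \<open>All eight identities are pointwise linear algebra.  Tangential and normal components of a vector
  are unique, because the differential is injective and the \<open>N\<^sub>\<alpha>\<close> are orthonormal and orthogonal to
  its image; comparing components in \<open>Pt (Pt X) = \<epsilon> X\<close> and \<open>Pt (Pt N\<^sub>\<alpha>) = \<epsilon> N\<^sub>\<alpha>\<close> gives (1), (2) and (5).
  Since \<open>Pt\<close> is an isometry with square \<open>\<epsilon>\<close>, it satisfies \<open>gt (Pt U) V = \<epsilon> gt U (Pt V)\<close>; evaluating this
  and the isometry condition on tangent and normal vectors gives the rest.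

  The hypotheses speak about vector fields, whereas the argument needs single tangent vectors such
  as \<open>P X\<close> at a point or the \<open>N\<^sub>\<alpha>\<close>, which are only given along the submanifold.  The bridge is that every
  tangent vector extends to a global smooth vector field, by a bump function in a chart.\<close>

section \<open>Smooth functions and bump functions\<close>

lemma frechet_derivative_cong_open:
  assumes "open S" "x \<in> S" "\<And>y. y \<in> S \<Longrightarrow> f y = g y"
  shows "frechet_derivative f (at x) = frechet_derivative g (at x)"
proof -
  \<comment> \<open>\<open>frechet_derivative\<close> is a Hilbert choice over the
    \<open>has_derivative\<close> predicate. Equality of the two predicates therefore gives equality
    of the chosen maps, also at points where neither function is differentiable.\<close>
  have "(f has_derivative D) (at x) \<longleftrightarrow> (g has_derivative D) (at x)" for D
    using assms by (metis (no_types, lifting) has_derivative_transform_within_open)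
  then show ?thesis
    by (simp add: frechet_derivative_def)
qed

lemma ck_on_cong:
  assumes "open S" "\<And>x. x \<in> S \<Longrightarrow> f x = g x" "ck_on k S f"
  shows "ck_on k S g"
  using assms(2,3)
proof (induction k arbitrary: f g)
  case 0
  then show ?case by simp (metis continuous_on_eq)
next
  case (Suc k)
  have "g differentiable (at x)" if "x \<in> S" for x
    using Suc.prems that assms(1) unfolding differentiable_def
    by (metis (no_types, lifting) ck_on.simps(2) differentiable_def has_derivative_transform_within_open)
  moreover have "ck_on k S (\<lambda>x. frechet_derivative g (at x) v)" for v
  proof (rule Suc.IH)
    show "ck_on k S (\<lambda>x. frechet_derivative f (at x) v)"
      using Suc.prems(2) by simp
    show "frechet_derivative f (at x) v = frechet_derivative g (at x) v" if "x \<in> S" for x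
      using frechet_derivative_cong_open[OF assms(1) that Suc.prems(1)] by simp
  qed
  ultimately show ?case by simp
qed

text \<open>Differentiability at a point and continuity at a point depend only on a neighbourhood.
  This glues a function that is given by different formulas on different open pieces, as the
  extension of a tangent vector is.\<close>

lemma ck_on_local:
  assumes "\<And>x. x \<in> S \<Longrightarrow> \<exists>U. open U \<and> x \<in> U \<and> ck_on k U f"
  shows "ck_on k S f"
  using assms
proof (induction k arbitrary: f)
  case 0
  then show ?case
    by (metis ck_on.simps(1) continuous_at_imp_continuous_on continuous_on_eq_continuous_at)
next
  case (Suc k)
  have "f differentiable (at x)" if "x \<in> S" for x
    using Suc.prems[OF that] by auto
  moreover have "ck_on k S (\<lambda>x. frechet_derivative f (at x) v)" for v
    by (rule Suc.IH) (use Suc.prems in \<open>fastforce\<close>)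
  ultimately show ?case by simp
qed

text \<open>\<open>ck_on (Suc k)\<close> asks for differentiability and for regularity of the
  directional derivatives; continuity is not part of it. The base case supplies it, since
  differentiable functions are continuous.\<close>

lemma ck_on_Suc_imp: "ck_on (Suc k) S f \<Longrightarrow> ck_on k S f"
proof (induction k arbitrary: f)
  case 0
  then show ?case
    by (auto intro!: continuous_at_imp_continuous_on differentiable_imp_continuous_within)
next
  case (Suc k)
  from Suc.prems have d: "\<forall>x\<in>S. f differentiable (at x)"
    and c: "ck_on (Suc k) S (\<lambda>x. frechet_derivative f (at x) v)" for v
    by (auto simp del: ck_on.simps simp: ck_on.simps(2)[of "Suc k"])
  show ?case using d Suc.IH[OF c] by simp
qed

text \<open>Uniqueness of the derivative lets an explicit formula \<open>D\<close> stand in for the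
  chosen \<open>frechet_derivative\<close>. The closure rules below all produce such
  formulas.\<close>

lemma ck_on_SucI:
  assumes "open S" "\<And>x. x \<in> S \<Longrightarrow> (f has_derivative D x) (at x)"
    and "\<And>v. ck_on k S (\<lambda>x. D x v)"
  shows "ck_on (Suc k) S f"
proof -
  have "ck_on k S (\<lambda>x. frechet_derivative f (at x) v)" for v
    by (rule ck_on_cong[OF assms(1) _ assms(3)[of v]]) (metis assms(2) frechet_derivative_at)
  then show ?thesis
    using assms(2) by (auto simp: differentiable_def)
qed

lemma ck_on_SucD:
  assumes "ck_on (Suc k) S f"
  shows "x \<in> S \<Longrightarrow> (f has_derivative frechet_derivative f (at x)) (at x)"
    and "ck_on k S (\<lambda>x. frechet_derivative f (at x) v)"
  using assms by (auto simp: frechet_derivative_works)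

section \<open>Closure of C^k functions under linear maps, sums, products and composition\<close>

lemma ck_on_const: "ck_on k S (\<lambda>_. c)"
  by (induction k arbitrary: c) auto

lemma ck_on_bounded_linear:
  assumes "open S" "bounded_linear h"
  shows "ck_on k S h"
proof (cases k)
  case 0
  then show ?thesis using assms by (simp add: linear_continuous_on)
next
  case (Suc k')
  show ?thesis unfolding Suc
    by (rule ck_on_SucI[where D = "\<lambda>_. h"])
      (use assms in \<open>auto intro: bounded_linear_imp_has_derivative ck_on_const\<close>)
qed

lemma ck_on_bounded_linear_compose:
  assumes "open S" "bounded_linear h" "ck_on k S f"
  shows "ck_on k S (\<lambda>x. h (f x))"
  using assms(3)
proof (induction k arbitrary: f)
  case 0
  then show ?case using bounded_linear.continuous_on[OF assms(2)] by simp
next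
  case (Suc k)
  show ?case
    by (rule ck_on_SucI[OF assms(1)
          bounded_linear.has_derivative[OF assms(2) ck_on_SucD(1)[OF Suc.prems]]])
      (assumption, rule Suc.IH, rule ck_on_SucD(2)[OF Suc.prems])
qed

lemma ck_on_add:
  assumes "open S" "ck_on k S f" "ck_on k S g"
  shows "ck_on k S (\<lambda>x. f x + g x)"
  using assms(2,3)
proof (induction k arbitrary: f g)
  case 0
  then show ?case by (simp add: continuous_on_add)
next
  case (Suc k)
  show ?case
    by (rule ck_on_SucI[OF assms(1) has_derivative_add[OF ck_on_SucD(1) ck_on_SucD(1)]])
      (use Suc in \<open>auto\<close>)
qed

lemma ck_on_sum:
  assumes "open S" "\<And>i. i \<in> I \<Longrightarrow> ck_on k S (f i)"
  shows "ck_on k S (\<lambda>x. \<Sum>i\<in>I. f i x)"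
  using assms(2)
  by (induction I rule: infinite_finite_induct)
    (auto intro!: ck_on_const ck_on_add[OF assms(1)])

text \<open>Product rule: each summand of the derivative pairs a directional derivative, which is
  C^k, with an undifferentiated factor, which is lowered from C^(k+1) to C^k.\<close>

lemma ck_on_scaleR:
  fixes f :: "'a::euclidean_space \<Rightarrow> real"
  assumes "open S" "ck_on k S f" "ck_on k S g"
  shows "ck_on k S (\<lambda>x. f x *\<^sub>R g x)"
  using assms(2,3)
proof (induction k arbitrary: f g)
  case 0
  then show ?case by (simp add: continuous_on_scaleR)
next
  case (Suc k)
  show ?case
  proof (rule ck_on_SucI[OF assms(1) has_derivative_scaleR[OF ck_on_SucD(1) ck_on_SucD(1)]])
    show "ck_on k S (\<lambda>x. f x *\<^sub>R frechet_derivative g (at x) v + frechet_derivative f (at x) v *\<^sub>R g x)" for v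
      by (intro ck_on_add[OF assms(1)] Suc.IH ck_on_SucD(2) Suc.prems ck_on_Suc_imp[OF Suc.prems(1)]
        ck_on_Suc_imp[OF Suc.prems(2)])
  qed (use Suc.prems in auto)
qed

text \<open>In the chain rule the direction \<open>h' v\<close> fed to the derivative of
  \<open>f\<close> varies with the point, whereas \<open>ck_on\<close> controls only fixed
  directions. Expanding the direction in \<open>Basis\<close> leaves a finite sum of scalar
  functions times partial derivatives of \<open>f\<close> along \<open>h\<close>, and the induction
  hypothesis, general in \<open>f\<close>, covers the latter.\<close>

lemma ck_on_compose:
  fixes h :: "'a::euclidean_space \<Rightarrow> 'b::euclidean_space"
  assumes "open S" "open T" "h ` S \<subseteq> T" "ck_on k S h" "ck_on k T f"
  shows "ck_on k S (f \<circ> h)"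
  using assms(4,5)
proof (induction k arbitrary: f)
  case 0
  then have "continuous_on S h" "continuous_on T f"
    by simp_all
  then have "continuous_on S h" "continuous_on (h ` S) f"
    by (simp_all add: continuous_on_subset[OF _ assms(3)])
  then show ?case
    unfolding ck_on.simps by (rule continuous_on_compose)
next
  case (Suc k)
  have hT: "h x \<in> T" if "x \<in> S" for x using assms(3) that by auto
  show ?case
  proof (rule ck_on_SucI[OF assms(1)])
    fix x assume x: "x \<in> S"
    let ?f' = "frechet_derivative f (at (h x))" and ?h' = "frechet_derivative h (at x)"
    have f': "(f has_derivative ?f') (at (h x))"
      by (rule ck_on_SucD(1)[OF Suc.prems(2) hT[OF x]])
    have "?f' w = (\<Sum>i\<in>Basis. (w \<bullet> i) *\<^sub>R ?f' i)" for w
    proof -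
      interpret linear ?f' using f' has_derivative_linear by blast
      have "?f' w = ?f' (\<Sum>i\<in>Basis. (w \<bullet> i) *\<^sub>R i)" by (simp add: euclidean_representation)
      then show ?thesis by (simp add: sum scaleR)
    qed
    then have "?f' \<circ> ?h' = (\<lambda>v. \<Sum>i\<in>Basis. (?h' v \<bullet> i) *\<^sub>R ?f' i)"
      unfolding o_def by (intro ext)
    with diff_chain_at[OF ck_on_SucD(1)[OF Suc.prems(1) x] f']
    show "(f \<circ> h has_derivative (\<lambda>v. \<Sum>i\<in>Basis. (?h' v \<bullet> i) *\<^sub>R ?f' i)) (at x)" by simp
  next
    fix v
    have "ck_on k S ((\<lambda>y. frechet_derivative f (at y) i) \<circ> h)" for i
      by (intro Suc.IH ck_on_Suc_imp[OF Suc.prems(1)] ck_on_SucD(2)[OF Suc.prems(2)])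
    then show "ck_on k S (\<lambda>x. \<Sum>i\<in>Basis. (frechet_derivative h (at x) v \<bullet> i) *\<^sub>R
        frechet_derivative f (at (h x)) i)"
      by (intro ck_on_sum[OF assms(1)] ck_on_scaleR[OF assms(1)]
          ck_on_bounded_linear_compose[OF assms(1) bounded_linear_inner_left]
          ck_on_SucD(2)[OF Suc.prems(1)]) (simp add: o_def)
  qed
qed

section \<open>A flat function and smooth bumps\<close>

text \<open>The derivative of each \<open>flat n\<close> is a linear combination of members of the family, so one
  induction, with \<open>n\<close> arbitrary, gives smoothness of all of them.\<close>

definition flat :: "nat \<Rightarrow> real \<Rightarrow> real" where
  "flat n t = (if t > 0 then inverse t ^ n * exp (- inverse t) else 0)"

text \<open>This is the difference quotient of \<open>flat n\<close> at 0. From the right, the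
  substitution s = 1/t turns it into s^(n+1) / exp s for s tending to infinity; from the left it is
  identically 0.\<close>

lemma flat_over_tendsto_0: "((\<lambda>t. flat n t / t) \<longlongrightarrow> 0) (at 0)"
proof (rule filterlim_split_at)
  show "((\<lambda>t. flat n t / t) \<longlongrightarrow> 0) (at_left 0)"
    by (rule tendsto_eventually) (auto simp: flat_def eventually_at intro!: exI[of _ 1])
  have "((\<lambda>t. inverse t ^ Suc n / exp (inverse t)) \<longlongrightarrow> (0::real)) (at_right 0)"
    by (rule filterlim_compose[OF tendsto_power_div_exp_0 filterlim_inverse_at_top_right])
  then show "((\<lambda>t. flat n t / t) \<longlongrightarrow> 0) (at_right 0)"
    by (rule Lim_transform_eventually)
      (auto simp: flat_def eventually_at exp_minus field_simps intro!: exI[of _ 1])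
qed

text \<open>For positive t the first term comes from the power, and the second from the exponential,
  whose inner derivative contributes the factor t^(-2). At 0 both terms are 0 by the default value
  of \<open>flat\<close>, and the preceding limit applies.\<close>

lemma flat_has_field_derivative:
  "(flat n has_field_derivative - real n * flat (Suc n) t + flat (Suc (Suc n)) t) (at t)"
proof -
  consider "t < 0" | "t = 0" | "t > 0" by linarith
  then show ?thesis
  proof cases
    case 1
    have "(flat n has_field_derivative 0) (at t)"
      by (rule has_field_derivative_transform_within_open[where f = "\<lambda>_. 0" and S = "{..<0}"])
        (use 1 in \<open>auto simp: flat_def\<close>)
    then show ?thesis using 1 by (simp add: flat_def)
  next
    case 2
    then show ?thesis
      using flat_over_tendsto_0[of n] by (simp add: has_field_derivative_iff flat_def)
  next
    case 3
    have "t \<noteq> 0" using 3 by simp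
    note d = DERIV_inverse[OF this]
    have p: "((\<lambda>t. inverse t ^ n) has_field_derivative - real n * inverse t ^ Suc n) (at t)"
      \<comment> \<open>The power rule has the exponent n - 1 with truncated subtraction, so n = 0
        is treated separately.\<close>
      by (rule DERIV_cong[OF DERIV_power[OF d]]) (cases n; simp add: algebra_simps)
    have e: "((\<lambda>t. exp (- inverse t)) has_field_derivative
        exp (- inverse t) * inverse t ^ Suc (Suc 0)) (at t)"
      using DERIV_fun_exp[OF DERIV_minus[OF d]] by simp
    have "((\<lambda>t. inverse t ^ n * exp (- inverse t)) has_field_derivative
        - real n * flat (Suc n) t + flat (Suc (Suc n)) t) (at t)"
      using DERIV_mult[OF p e] 3 by (simp add: flat_def ac_simps)
    then show ?thesis
      by (rule has_field_derivative_transform_within_open[where S = "{0<..}"])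
        (use 3 in \<open>auto simp: flat_def\<close>)
  qed
qed

lemma ck_on_flat: "ck_on k UNIV (flat n)"
proof (induction k arbitrary: n)
  case 0
  show ?case
    using flat_has_field_derivative
    by (auto intro!: continuous_at_imp_continuous_on DERIV_isCont)
next
  case (Suc k)
  show ?case
  proof (rule ck_on_SucI)
    show "(flat n has_derivative (\<lambda>v. v *\<^sub>R ((- real n) *\<^sub>R flat (Suc n) x + flat (Suc (Suc n)) x))) (at x)" for x
      using flat_has_field_derivative[of n x] by (simp add: has_field_derivative_def mult.commute[of _ "_ + _"] mult_commute_abs)
  qed (intro open_UNIV ck_on_scaleR ck_on_add ck_on_const Suc.IH)+
qed

lemma smooth_bump:
  fixes x0 :: "'a::euclidean_space"
  assumes "e > 0"
  obtains b where "smooth_on UNIV b" "b x0 = (1::real)" "\<And>x. dist x0 x \<ge> e \<Longrightarrow> b x = 0"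
proof
  \<comment> \<open>This is e^2 - (dist x0 x)^2 written out in coordinates, so that the closure
    rules for sums and products show its smoothness. It is positive exactly on the open ball of
    radius e, and \<open>?b\<close> below composes it with \<open>flat 0\<close> and normalises the
    value at the centre.\<close>
  let ?s = "\<lambda>x. e\<^sup>2 + (\<Sum>i\<in>Basis. (x \<bullet> i - x0 \<bullet> i) *\<^sub>R (x0 \<bullet> i - x \<bullet> i))"
  have s: "?s x = e\<^sup>2 - (dist x0 x)\<^sup>2" for x
  proof -
    have "(x \<bullet> i - x0 \<bullet> i) *\<^sub>R (x0 \<bullet> i - x \<bullet> i) = - (((x0 - x) \<bullet> i) * ((x0 - x) \<bullet> i))" for i
      by (simp add: inner_diff_left algebra_simps)
    then show ?thesis
      by (simp only: sum_negf dist_norm power2_norm_eq_inner euclidean_inner[symmetric])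
  qed
  have sm: "ck_on k UNIV ?s" for k
  proof -
    have "ck_on k UNIV (\<lambda>x. x \<bullet> i + - (x0 \<bullet> i))" "ck_on k UNIV (\<lambda>x. x0 \<bullet> i + - 1 *\<^sub>R (x \<bullet> i))" for i
      by (intro ck_on_add ck_on_const ck_on_bounded_linear bounded_linear_inner_left open_UNIV
          ck_on_scaleR)+
    then show ?thesis
      by (intro ck_on_add ck_on_sum ck_on_scaleR open_UNIV ck_on_const) auto
  qed
  let ?b = "\<lambda>x. inverse (flat 0 (e\<^sup>2)) *\<^sub>R flat 0 (?s x)"
  have "ck_on k UNIV (flat 0 \<circ> ?s)" for k
    by (rule ck_on_compose[OF _ _ _ sm ck_on_flat]) auto
  then show "smooth_on UNIV ?b"
    unfolding smooth_on_def
    by (intro allI ck_on_scaleR open_UNIV ck_on_const) (simp add: o_def)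
  show "?b x0 = 1" using assms by (simp add: flat_def)
  show "?b x = 0" if "dist x0 x \<ge> e" for x
  proof -
    have "e\<^sup>2 \<le> (dist x0 x)\<^sup>2" using that assms by (intro power_mono) auto
    then show ?thesis unfolding s by (simp add: flat_def)
  qed
qed

section \<open>Tangent vectors and differentials\<close>

lemma smooth_on_has_derivative:
  "smooth_on S f \<Longrightarrow> x \<in> S \<Longrightarrow> (f has_derivative frechet_derivative f (at x)) (at x)"
  unfolding smooth_on_def using ck_on_SucD(1) by blast

lemma smooth_on_frechet_derivative:
  "smooth_on S f \<Longrightarrow> smooth_on S (\<lambda>x. frechet_derivative f (at x) v)"
  unfolding smooth_on_def using ck_on_SucD(2) by blast

section \<open>Charts and changes of chart\<close>

lemma chart_openin: "smooth_manifold M \<Longrightarrow> c \<in> atlas M \<Longrightarrow> openin (mtop M) (cdom c)"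
  by (simp add: smooth_manifold_def)

lemma chart_homeomorphic_map:
  "smooth_manifold M \<Longrightarrow> c \<in> atlas M \<Longrightarrow>
    homeomorphic_map (subtopology (mtop M) (cdom c)) (top_of_set (cmap c ` cdom c)) (cmap c)"
  by (simp add: smooth_manifold_def)

lemma topspace_chart:
  "smooth_manifold M \<Longrightarrow> c \<in> atlas M \<Longrightarrow> topspace (subtopology (mtop M) (cdom c)) = cdom c"
  using openin_subset[OF chart_openin] by fastforce

lemma chart_exists:
  assumes "smooth_manifold M" "p \<in> points M"
  obtains c where "c \<in> atlas M" "p \<in> cdom c"
  using assms unfolding smooth_manifold_def by blast

lemma cinv_cmap:
  assumes "smooth_manifold M" "c \<in> atlas M" "p \<in> cdom c"
  shows "cinv c (cmap c p) = p"
proof -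
  have "inj_on (cmap c) (cdom c)"
    using homeomorphic_imp_injective_map[OF chart_homeomorphic_map[OF assms(1,2)]]
    unfolding topspace_chart[OF assms(1,2)] .
  then show ?thesis using assms(3) by (simp add: cinv_def)
qed

lemma open_chart_image:
  assumes "smooth_manifold M" "c \<in> atlas M" "openin (mtop M) W" "W \<subseteq> cdom c"
  shows "open (cmap c ` W)"
proof -
  have "openin (top_of_set (cmap c ` cdom c)) (cmap c ` W)"
    using homeomorphic_imp_open_map[OF chart_homeomorphic_map[OF assms(1,2)]] assms
    by (auto simp: open_map_def openin_open_subtopology chart_openin)
  moreover have "open (cmap c ` cdom c)"
    using assms by (simp add: smooth_manifold_def)
  ultimately show ?thesis using openin_open_trans by blast
qed

lemma open_overlap_image:
  assumes "smooth_manifold M" "c \<in> atlas M" "d \<in> atlas M"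
  shows "open (cmap c ` (cdom c \<inter> cdom d))"
  by (rule open_chart_image) (use assms in \<open>auto intro: chart_openin\<close>)

lemma smooth_on_transition:
  assumes "smooth_manifold M" "c \<in> atlas M" "d \<in> atlas M"
  shows "smooth_on (cmap c ` (cdom c \<inter> cdom d)) (cmap d \<circ> cinv c)"
  using assms by (simp add: smooth_manifold_def)

lemma transition_has_derivative:
  assumes "smooth_manifold M" "c \<in> atlas M" "d \<in> atlas M" "p \<in> cdom c" "p \<in> cdom d"
  shows "((cmap d \<circ> cinv c) has_derivative frechet_derivative (cmap d \<circ> cinv c) (at (cmap c p)))
    (at (cmap c p))"
  by (rule smooth_on_has_derivative[OF smooth_on_transition]) (use assms in auto)

text \<open>On \<open>S\<close> the map \<open>F\<close> lands in the domain of \<open>d\<close>, so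
  there \<open>cmap d' \<circ> F\<close> factors through the transition map from \<open>d\<close> to
  \<open>d'\<close>. With \<open>F = cinv c\<close> this shows that \<open>coord_vec\<close> is a
  tangent vector; with \<open>F = f \<circ> cinv c\<close> it shows the same for values of the
  differential.\<close>

lemma chart_chain_rule:
  assumes M: "smooth_manifold M" and d: "d \<in> atlas M" and d': "d' \<in> atlas M"
    and S: "open S" "x \<in> S" "F ` S \<subseteq> cdom d" and Fx: "F x \<in> cdom d'"
    and diff: "((cmap d \<circ> F) has_derivative D) (at x)"
  shows "frechet_derivative (cmap d' \<circ> F) (at x) =
    frechet_derivative (cmap d' \<circ> cinv d) (at (cmap d (F x))) \<circ> D"
proof -
  have "F x \<in> cdom d" using S by auto
  then have "((cmap d' \<circ> cinv d) \<circ> (cmap d \<circ> F) has_derivative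
      frechet_derivative (cmap d' \<circ> cinv d) (at (cmap d (F x))) \<circ> D) (at x)"
    using diff_chain_at[OF diff] transition_has_derivative[OF M d d' _ Fx] by simp
  then have "(cmap d' \<circ> F has_derivative
      frechet_derivative (cmap d' \<circ> cinv d) (at (cmap d (F x))) \<circ> D) (at x)"
    by (rule has_derivative_transform_within_open[OF _ S(1,2)])
      (use S(3) in \<open>auto simp: cinv_cmap[OF M d]\<close>)
  then show ?thesis by (rule frechet_derivative_at[symmetric])
qed

section \<open>Tangent spaces and extension of tangent vectors\<close>

lemma coord_vec_in_tangent_space:
  assumes M: "smooth_manifold M" and c: "c \<in> atlas M" and q: "q \<in> cdom c"
  shows "coord_vec M c e q \<in> tangent_space M q"
  unfolding tangent_space_def
proof (intro CollectI conjI allI impI ballI)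
  fix d d' assume d: "d \<in> atlas M" and d': "d' \<in> atlas M" and dd: "q \<in> cdom d \<and> q \<in> cdom d'"
  have "frechet_derivative (cmap d' \<circ> cinv c) (at (cmap c q)) =
      frechet_derivative (cmap d' \<circ> cinv d) (at (cmap d (cinv c (cmap c q)))) \<circ>
      frechet_derivative (cmap d \<circ> cinv c) (at (cmap c q))"
    by (rule chart_chain_rule[OF M d d' open_overlap_image[OF M c d]])
      (use dd q cinv_cmap[OF M c] transition_has_derivative[OF M c d] in auto)
  then show "coord_vec M c e q d' =
      frechet_derivative (cmap d' \<circ> cinv d) (at (cmap d q)) (coord_vec M c e q d)"
    using dd d d' by (simp add: coord_vec_def cinv_cmap[OF M c q])
qed (auto simp: coord_vec_def)

lemma tangent_space_transition:
  "v \<in> tangent_space M p \<Longrightarrow> c \<in> atlas M \<Longrightarrow> d \<in> atlas M \<Longrightarrow> p \<in> cdom c \<Longrightarrow> p \<in> cdom d \<Longrightarrow>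
    v d = frechet_derivative (cmap d \<circ> cinv c) (at (cmap c p)) (v c)"
  unfolding tangent_space_def by blast

lemma tangent_space_eq_0:
  "v \<in> tangent_space M p \<Longrightarrow> c \<notin> atlas M \<or> p \<notin> cdom c \<Longrightarrow> v c = 0"
  unfolding tangent_space_def by blast

lemma subspace_tangent_space:
  assumes M: "smooth_manifold M"
  shows "subspace (tangent_space M p)"
proof -
  have lin: "linear (frechet_derivative (cmap d \<circ> cinv c) (at (cmap c p)))"
    if "c \<in> atlas M" "d \<in> atlas M" "p \<in> cdom c" "p \<in> cdom d" for c d
    using transition_has_derivative[OF M that] has_derivative_linear by blast
  show ?thesis
  proof (rule subspaceI)
    show "0 \<in> tangent_space M p"
      unfolding tangent_space_def
    proof (intro CollectI conjI allI ballI impI)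
      fix c d assume "c \<in> atlas M" "d \<in> atlas M" "p \<in> cdom c \<and> p \<in> cdom d"
      then show "0 d = frechet_derivative (cmap d \<circ> cinv c) (at (cmap c p)) (0 c)"
        using linear_0[OF lin[of c d]] by simp
    qed simp
  next
    fix v w assume v: "v \<in> tangent_space M p" and w: "w \<in> tangent_space M p"
    show "v + w \<in> tangent_space M p"
      unfolding tangent_space_def
    proof (intro CollectI conjI allI ballI impI)
      fix c d assume cd: "c \<in> atlas M" "d \<in> atlas M" and p: "p \<in> cdom c \<and> p \<in> cdom d"
      show "(v + w) d = frechet_derivative (cmap d \<circ> cinv c) (at (cmap c p)) ((v + w) c)"
        unfolding plus_fun_apply linear_add[OF lin[OF cd conjunct1[OF p] conjunct2[OF p]]]
        by (rule arg_cong2[where f = plus])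
          (rule tangent_space_transition; use v w cd p in simp)+
    qed (simp add: tangent_space_eq_0[OF v] tangent_space_eq_0[OF w])
  next
    fix a :: real and v assume v: "v \<in> tangent_space M p"
    show "a *\<^sub>R v \<in> tangent_space M p"
      unfolding tangent_space_def
    proof (intro CollectI conjI allI ballI impI)
      fix c d assume cd: "c \<in> atlas M" "d \<in> atlas M" and p: "p \<in> cdom c \<and> p \<in> cdom d"
      show "(a *\<^sub>R v) d = frechet_derivative (cmap d \<circ> cinv c) (at (cmap c p)) ((a *\<^sub>R v) c)"
        unfolding scaleR_fun_apply linear_scale[OF lin[OF cd conjunct1[OF p] conjunct2[OF p]]]
        by (rule arg_cong[where f = "scaleR a"])
          (rule tangent_space_transition; use v cd p in simp)
    qed (simp add: tangent_space_eq_0[OF v])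
  qed
qed

lemma coord_vec_eq:
  assumes "v \<in> tangent_space M p" "c \<in> atlas M" "p \<in> cdom c"
  shows "coord_vec M c (v c) p = v"
proof
  show "coord_vec M c (v c) p d = v d" for d
  proof (cases "d \<in> atlas M \<and> p \<in> cdom d")
    case True
    then show ?thesis
      using tangent_space_transition[OF assms(1,2) _ assms(3), of d] unfolding coord_vec_def by simp
  next
    case False
    then show ?thesis
      using tangent_space_eq_0[OF assms(1), of d] unfolding coord_vec_def by auto
  qed
qed

text \<open>The field with constant coordinates \<open>v c\<close> in one chart is cut off by a bump
  and continued by 0. In any chart \<open>d\<close>, smoothness is checked on two open sets that
  cover its image: the overlap with \<open>c\<close>, and the part outside \<open>K\<close>, where
  the field vanishes.\<close>

lemma tangent_vector_extends:
  fixes M :: "('p, 'e::euclidean_space) manifold"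
  assumes M: "smooth_manifold M" and p: "p \<in> points M" and v: "v \<in> tangent_space M p"
  obtains X where "X \<in> vector_fields M" "X p = v"
proof -
  obtain c where c: "c \<in> atlas M" and pc: "p \<in> cdom c"
    using chart_exists[OF M p] .
  have "open (cmap c ` cdom c)"
    by (rule open_chart_image[OF M c chart_openin[OF M c]]) simp
  then obtain e where e: "e > 0" and ball: "cball (cmap c p) e \<subseteq> cmap c ` cdom c"
    using pc open_contains_cball by blast
  obtain b where b: "smooth_on UNIV b" "b (cmap c p) = (1::real)"
    and b0: "\<And>x. dist (cmap c p) x \<ge> e \<Longrightarrow> b x = 0"
    using smooth_bump[OF e] by blast
  define X where "X q = (if q \<in> cdom c then b (cmap c q) *\<^sub>R coord_vec M c (v c) q else 0)" for q
  define K where "K = {q \<in> cdom c. cmap c q \<in> cball (cmap c p) e}"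
  \<comment> \<open>Being closed in the chart domain would not make the complement of
    \<open>K\<close> open in \<open>M\<close>. The chart carries \<open>K\<close> to a closed ball,
    so \<open>K\<close> is compact, hence closed because \<open>M\<close> is Hausdorff.\<close>
  have closed: "closedin (mtop M) K"
  proof -
    have "cmap c ` K = cball (cmap c p) e" using ball by (auto simp: K_def)
    then have "compactin (top_of_set (cmap c ` cdom c)) (cmap c ` K)"
      using ball by (simp add: compactin_subtopology)
    then have "compactin (mtop M) K"
      using homeomorphic_map_compactness[OF chart_homeomorphic_map[OF M c], of K]
        topspace_chart[OF M c] by (auto simp: K_def compactin_subtopology)
    then show ?thesis
      using M compactin_imp_closedin unfolding smooth_manifold_def by blast
  qed
  have X0: "X q = 0" if "q \<notin> K" for q
    using that b0[of "cmap c q"] by (auto simp: X_def K_def)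
  have "X \<in> vector_fields M"
    unfolding vector_fields_def
  proof (intro CollectI conjI ballI)
    show "X q \<in> tangent_space M q" for q
      using coord_vec_in_tangent_space[OF M c] subspace_tangent_space[OF M]
      by (auto simp: X_def subspace_scale subspace_0)
  next
    fix d assume d: "d \<in> atlas M"
    let ?A = "cmap d ` (cdom d \<inter> cdom c)" and ?B = "cmap d ` (cdom d - K)"
    let ?h = "cmap c \<circ> cinv d"
    have A: "open ?A" by (rule open_overlap_image[OF M d c])
    have B: "open ?B"
      by (rule open_chart_image[OF M d]) (use closed chart_openin[OF M d] in \<open>auto intro: openin_diff\<close>)
    have eqB: "X (cinv d x) d = 0" if "x \<in> ?B" for x
      using that cinv_cmap[OF M d] X0 by auto
    \<comment> \<open>For x = \<open>cmap d q\<close> the point \<open>?h x\<close> is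
      \<open>cmap c q\<close>, so both factors are fixed smooth functions of the
      \<open>c\<close>-coordinates composed with the transition map \<open>?h\<close>.\<close>
    have eqA: "X (cinv d x) d =
        b (?h x) *\<^sub>R frechet_derivative (cmap d \<circ> cinv c) (at (?h x)) (v c)" if "x \<in> ?A" for x
      using that cinv_cmap[OF M d] d by (auto simp: X_def coord_vec_def)
    have hA: "?h ` ?A \<subseteq> cmap c ` (cdom c \<inter> cdom d)"
      using cinv_cmap[OF M d] by auto
    have "ck_on k ?B (\<lambda>x. X (cinv d x) d)" for k
      by (rule ck_on_cong[OF B _ ck_on_const]) (use eqB in auto)
    moreover have "ck_on k ?A (\<lambda>x. X (cinv d x) d)" for k
    proof -
      have h: "ck_on k ?A ?h"
        using smooth_on_transition[OF M d c] by (simp add: smooth_on_def)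
      have "ck_on k ?A (b \<circ> ?h)"
        by (rule ck_on_compose[OF A open_UNIV _ h]) (use b(1) in \<open>auto simp: smooth_on_def\<close>)
      moreover have "ck_on k ?A ((\<lambda>y. frechet_derivative (cmap d \<circ> cinv c) (at y) (v c)) \<circ> ?h)"
        by (rule ck_on_compose[OF A open_overlap_image[OF M c d] hA h])
          (use smooth_on_frechet_derivative[OF smooth_on_transition[OF M c d]] in \<open>simp add: smooth_on_def\<close>)
      ultimately have "ck_on k ?A (\<lambda>x. (b \<circ> ?h) x *\<^sub>R
          ((\<lambda>y. frechet_derivative (cmap d \<circ> cinv c) (at y) (v c)) \<circ> ?h) x)"
        by (rule ck_on_scaleR[OF A])
      then show ?thesis
        by (rule ck_on_cong[OF A, rotated]) (simp add: eqA)
    qed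
    moreover have "x \<in> ?A \<or> x \<in> ?B" if "x \<in> cmap d ` cdom d" for x
      using that by (auto simp: K_def)
    ultimately have "\<exists>U. open U \<and> x \<in> U \<and> ck_on k U (\<lambda>x. X (cinv d x) d)"
      if "x \<in> cmap d ` cdom d" for x k
      using A B that by meson
    then show "smooth_on (cmap d ` cdom d) (\<lambda>x. X (cinv d x) d)"
      unfolding smooth_on_def by (intro allI ck_on_local)
  qed
  moreover have "X p = v" using pc b(2) coord_vec_eq[OF v c pc] by (simp add: X_def)
  ultimately show ?thesis by (rule that)
qed

section \<open>The differential of a smooth map\<close>

lemma differential_has_derivative:
  assumes M: "smooth_manifold M" and N: "smooth_manifold N" and f: "smooth_map M N f"
    and c: "c \<in> atlas M" "p \<in> cdom c" and d: "d \<in> atlas N" "f p \<in> cdom d"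
  shows "open (cmap c ` {q \<in> cdom c. f q \<in> cdom d})"
    and "((cmap d \<circ> f \<circ> cinv c) has_derivative
      frechet_derivative (cmap d \<circ> f \<circ> cinv c) (at (cmap c p))) (at (cmap c p))"
proof -
  have cont: "continuous_map (mtop M) (mtop N) f" using f by (simp add: smooth_map_def)
  have "{q \<in> cdom c. f q \<in> cdom d} = cdom c \<inter> {q \<in> points M. f q \<in> cdom d}"
    using openin_subset[OF chart_openin[OF M c(1)]] by auto
  then have "openin (mtop M) {q \<in> cdom c. f q \<in> cdom d}"
    by (simp only: openin_Int[OF chart_openin[OF M c(1)]
          openin_continuous_map_preimage[OF cont chart_openin[OF N d(1)]]])
  then show "open (cmap c ` {q \<in> cdom c. f q \<in> cdom d})"
    by (rule open_chart_image[OF M c(1)]) auto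
  have "smooth_on (cmap c ` {q \<in> cdom c. f q \<in> cdom d}) (cmap d \<circ> f \<circ> cinv c)"
    using f c(1) d(1) unfolding smooth_map_def by blast
  then show "((cmap d \<circ> f \<circ> cinv c) has_derivative
      frechet_derivative (cmap d \<circ> f \<circ> cinv c) (at (cmap c p))) (at (cmap c p))"
    by (rule smooth_on_has_derivative) (use c d in auto)
qed

text \<open>Resolves the choice operator in \<open>differential\<close> once: the chart is the same
  for all vectors and all target charts, so membership and linearity can be proved with a fixed
  \<open>c\<close>.\<close>

lemma differential_chart:
  assumes "smooth_manifold M" "p \<in> points M"
  obtains c where "c \<in> atlas M" "p \<in> cdom c"
    and "differential M N f p = (\<lambda>v d. if d \<in> atlas N \<and> f p \<in> cdom d
      then frechet_derivative (cmap d \<circ> f \<circ> cinv c) (at (cmap c p)) (v c) else 0)"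
proof -
  define c where "c = (SOME c. c \<in> atlas M \<and> p \<in> cdom c)"
  have "\<exists>c. c \<in> atlas M \<and> p \<in> cdom c"
    using chart_exists[OF assms] by blast
  then have "c \<in> atlas M \<and> p \<in> cdom c"
    unfolding c_def by (rule someI_ex)
  then show ?thesis
    using that[of c] by (simp add: differential_def c_def Let_def fun_eq_iff)
qed

lemma differential_in_tangent_space:
  assumes M: "smooth_manifold M" and N: "smooth_manifold N" and f: "smooth_map M N f"
    and p: "p \<in> points M"
  shows "differential M N f p v \<in> tangent_space N (f p)"
proof -
  obtain c where c: "c \<in> atlas M" "p \<in> cdom c"
    and eq: "differential M N f p = (\<lambda>v d. if d \<in> atlas N \<and> f p \<in> cdom d
      then frechet_derivative (cmap d \<circ> f \<circ> cinv c) (at (cmap c p)) (v c) else 0)"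
    by (rule differential_chart[OF M p, where N = N and f = f])
  show ?thesis
    unfolding tangent_space_def
  proof (intro CollectI conjI allI impI ballI)
    fix d d' assume d: "d \<in> atlas N" and d': "d' \<in> atlas N" and dd: "f p \<in> cdom d \<and> f p \<in> cdom d'"
    have "frechet_derivative (cmap d' \<circ> (f \<circ> cinv c)) (at (cmap c p)) =
        frechet_derivative (cmap d' \<circ> cinv d) (at (cmap d ((f \<circ> cinv c) (cmap c p)))) \<circ>
        frechet_derivative (cmap d \<circ> f \<circ> cinv c) (at (cmap c p))"
      by (rule chart_chain_rule[OF N d d' differential_has_derivative(1)[OF M N f c d]])
        (use dd c cinv_cmap[OF M c(1)] differential_has_derivative(2)[OF M N f c d] in
          \<open>auto simp: o_assoc\<close>)
    then show "differential M N f p v d' =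
        frechet_derivative (cmap d' \<circ> cinv d) (at (cmap d (f p))) (differential M N f p v d)"
      using dd d d' by (simp add: eq o_assoc cinv_cmap[OF M c])
  qed (auto simp: eq)
qed

lemma linear_differential:
  assumes M: "smooth_manifold M" and N: "smooth_manifold N" and f: "smooth_map M N f"
    and p: "p \<in> points M"
  shows "linear (differential M N f p)"
proof -
  obtain c where c: "c \<in> atlas M" "p \<in> cdom c"
    and eq: "differential M N f p = (\<lambda>v d. if d \<in> atlas N \<and> f p \<in> cdom d
      then frechet_derivative (cmap d \<circ> f \<circ> cinv c) (at (cmap c p)) (v c) else 0)"
    by (rule differential_chart[OF M p, where N = N and f = f])
  have lin: "linear (frechet_derivative (cmap d \<circ> f \<circ> cinv c) (at (cmap c p)))"
    if "d \<in> atlas N" "f p \<in> cdom d" for d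
    using differential_has_derivative(2)[OF M N f c that] has_derivative_linear by blast
  show ?thesis
  proof (rule linearI; rule ext)
    show "differential M N f p (v + w) d = (differential M N f p v + differential M N f p w) d" for v w d
      by (cases "d \<in> atlas N \<and> f p \<in> cdom d") (auto simp: eq linear_add[OF lin])
    show "differential M N f p (t *\<^sub>R v) d = (t *\<^sub>R differential M N f p v) d" for t v d
      by (cases "d \<in> atlas N \<and> f p \<in> cdom d") (auto simp: eq linear_scale[OF lin])
  qed
qed

section \<open>Structures induced on a subspace\<close>

text \<open>Additivity is available only for arguments in \<open>V\<close>, so the induction keeps
  the partial sums inside \<open>V\<close>. The value \<open>f 0 = 0\<close> settles the empty and
  the infinite index set.\<close>

lemma linear_within_sum:
  assumes V: "subspace V" and f: "linear_within V f" and x: "\<And>i. i \<in> I \<Longrightarrow> x i \<in> V"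
  shows "f (\<Sum>i\<in>I. c i *\<^sub>R x i) = (\<Sum>i\<in>I. c i *\<^sub>R f (x i))"
proof -
  have f0: "f 0 = 0"
    using f subspace_0[OF V] unfolding linear_within_def by (metis scaleR_zero_left)
  show ?thesis
    using x
  proof (induction I rule: infinite_finite_induct)
    case (insert i I)
    have "(\<Sum>i\<in>I. c i *\<^sub>R x i) \<in> V" "c i *\<^sub>R x i \<in> V" "x i \<in> V"
      using insert.prems by (auto intro!: subspace_sum[OF V] subspace_scale[OF V])
    then show ?case
      using f insert by (simp add: linear_within_def)
  qed (simp_all add: f0)
qed

text \<open>The situation at a single point of the submanifold: \<open>T\<close> and \<open>V\<close> are the tangent spaces of the
  submanifold and of the ambient manifold, \<open>L\<close> is the differential of the immersion, \<open>G\<close> the ambient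
  metric and \<open>J\<close> the ambient tensor \<open>Pt\<close>.\<close>

locale induced_decomposition =
  fixes T :: "'v::real_vector set" and V :: "'w::real_vector set"
    and L :: "'v \<Rightarrow> 'w" and G :: "'w \<Rightarrow> 'w \<Rightarrow> real" and J :: "'w \<Rightarrow> 'w"
    and \<epsilon> :: real and r :: nat and \<nu> :: "nat \<Rightarrow> 'w"
    and P :: "'v \<Rightarrow> 'v" and u :: "nat \<Rightarrow> 'v \<Rightarrow> real" and \<xi> :: "nat \<Rightarrow> 'v"
    and a :: "nat \<Rightarrow> nat \<Rightarrow> real"
  assumes eps: "\<epsilon> * \<epsilon> = 1"
    and T: "subspace T" and V: "subspace V"
    and L: "linear L" and L_V: "\<And>v. v \<in> T \<Longrightarrow> L v \<in> V" and L_inj: "inj_on L T"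
    and G_linear: "\<And>x. x \<in> V \<Longrightarrow> linear_within V (G x)"
    and G_sym: "\<And>x y. x \<in> V \<Longrightarrow> y \<in> V \<Longrightarrow> G x y = G y x"
    and J_V: "\<And>x. x \<in> V \<Longrightarrow> J x \<in> V" and J_linear: "linear_within V J"
    and J_J: "\<And>x. x \<in> V \<Longrightarrow> J (J x) = \<epsilon> *\<^sub>R x"
    and G_J_J: "\<And>x y. x \<in> V \<Longrightarrow> y \<in> V \<Longrightarrow> G (J x) (J y) = G x y"
    and \<nu>_V: "\<And>\<alpha>. \<alpha> \<in> {1..r} \<Longrightarrow> \<nu> \<alpha> \<in> V"
    and G_L_\<nu>: "\<And>v \<alpha>. v \<in> T \<Longrightarrow> \<alpha> \<in> {1..r} \<Longrightarrow> G (L v) (\<nu> \<alpha>) = 0"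
    and G_\<nu>_\<nu>: "\<And>\<alpha> \<beta>. \<alpha> \<in> {1..r} \<Longrightarrow> \<beta> \<in> {1..r} \<Longrightarrow> G (\<nu> \<alpha>) (\<nu> \<beta>) = (if \<alpha> = \<beta> then 1 else 0)"
    and P_T: "\<And>v. v \<in> T \<Longrightarrow> P v \<in> T" and P_linear: "linear_within T P"
    and \<xi>_T: "\<And>\<alpha>. \<alpha> \<in> {1..r} \<Longrightarrow> \<xi> \<alpha> \<in> T"
    and J_L: "\<And>v. v \<in> T \<Longrightarrow> J (L v) = L (P v) + (\<Sum>\<alpha>=1..r. u \<alpha> v *\<^sub>R \<nu> \<alpha>)"
    and J_\<nu>: "\<And>\<alpha>. \<alpha> \<in> {1..r} \<Longrightarrow>
      J (\<nu> \<alpha>) = \<epsilon> *\<^sub>R L (\<xi> \<alpha>) + (\<Sum>\<beta>=1..r. a \<alpha> \<beta> *\<^sub>R \<nu> \<beta>)"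
begin

text \<open>Coordinates for tangent plus normal part: all vectors below are brought to this form, so
  that an equation of ambient vectors splits into two component equations. Only the values of
  \<open>c\<close> on \<open>{1..r}\<close> matter, which is why \<open>dec_eqD\<close> compares
  coefficients there only.\<close>

definition dec :: "'v \<Rightarrow> (nat \<Rightarrow> real) \<Rightarrow> 'w" where
  "dec v c = L v + (\<Sum>\<alpha>=1..r. c \<alpha> *\<^sub>R \<nu> \<alpha>)"

lemma normal_part_V: "(\<Sum>\<alpha>=1..r. c \<alpha> *\<^sub>R \<nu> \<alpha>) \<in> V"
  by (intro subspace_sum[OF V] subspace_scale[OF V] \<nu>_V)

lemma dec_V: "v \<in> T \<Longrightarrow> dec v c \<in> V"
  unfolding dec_def by (intro subspace_add[OF V] L_V normal_part_V)

lemma linear_within_normal_part: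
  assumes "linear_within V f"
  shows "f (\<Sum>\<alpha>=1..r. c \<alpha> *\<^sub>R \<nu> \<alpha>) = (\<Sum>\<alpha>=1..r. c \<alpha> *\<^sub>R f (\<nu> \<alpha>))"
  by (rule linear_within_sum[OF V assms \<nu>_V])

lemma G_dec:
  assumes x: "x \<in> V" and v: "v \<in> T"
  shows "G x (dec v c) = G x (L v) + (\<Sum>\<alpha>=1..r. c \<alpha> * G x (\<nu> \<alpha>))"
  using G_linear[OF x] L_V[OF v] normal_part_V[of c] linear_within_normal_part[OF G_linear[OF x], of c]
  by (simp add: dec_def linear_within_def)

lemma G_scale: "x \<in> V \<Longrightarrow> y \<in> V \<Longrightarrow> G x (t *\<^sub>R y) = t * G x y"
  using G_linear by (simp add: linear_within_def)

lemma G_dec_\<nu>: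
  assumes "v \<in> T" "\<alpha> \<in> {1..r}"
  shows "G (dec v c) (\<nu> \<alpha>) = c \<alpha>"
proof -
  \<comment> \<open>The locale gives linearity of \<open>G\<close> in the second argument, so a
    decomposed first argument is moved there by symmetry.\<close>
  have "G (dec v c) (\<nu> \<alpha>) = G (\<nu> \<alpha>) (dec v c)"
    by (intro G_sym dec_V \<nu>_V assms)
  also have "\<dots> = (\<Sum>\<beta>=1..r. c \<beta> * (if \<alpha> = \<beta> then 1 else 0))"
    using G_dec[OF \<nu>_V[OF assms(2)] assms(1)] G_L_\<nu>[OF assms]
      G_sym[OF \<nu>_V[OF assms(2)] L_V[OF assms(1)]] G_\<nu>_\<nu>[OF assms(2)] by simp
  also have "\<dots> = c \<alpha>"
    using assms by (simp add: if_distrib cong: if_cong)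
  finally show ?thesis .
qed

text \<open>Pythagoras: tangent and normal parts are orthogonal, and the frame is
  orthonormal.\<close>

lemma G_dec_dec:
  assumes v: "v \<in> T" and w: "w \<in> T"
  shows "G (dec v c) (dec w b) = G (L v) (L w) + (\<Sum>\<alpha>=1..r. c \<alpha> * b \<alpha>)"
proof -
  have "G (dec v c) (L w) = G (L w) (dec v c)"
    by (intro G_sym dec_V L_V assms)
  also have "\<dots> = G (L v) (L w)"
    using G_L_\<nu>[OF w] G_sym[OF L_V[OF w] L_V[OF v]] by (simp add: G_dec[OF L_V[OF w] v])
  finally show ?thesis
    using G_dec_\<nu>[OF v] by (simp add: G_dec[OF dec_V[OF v] w] mult.commute)
qed

text \<open>Pairing with the frame gives the normal coefficients first; cancelling them leaves an
  equation between values of \<open>L\<close>, where injectivity applies.\<close>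

lemma dec_eqD:
  assumes eq: "dec v c = dec w b" and v: "v \<in> T" and w: "w \<in> T"
  shows "v = w" and "\<And>\<alpha>. \<alpha> \<in> {1..r} \<Longrightarrow> c \<alpha> = b \<alpha>"
proof -
  show cb: "c \<alpha> = b \<alpha>" if "\<alpha> \<in> {1..r}" for \<alpha>
    using G_dec_\<nu>[OF v that, of c] G_dec_\<nu>[OF w that, of b] eq by simp
  have "L v = L w" using eq cb by (simp add: dec_def)
  then show "v = w" using L_inj v w by (simp add: inj_on_eq_iff)
qed

lemma scaleR_dec: "t *\<^sub>R dec v c = dec (t *\<^sub>R v) (\<lambda>\<alpha>. t * c \<alpha>)"
  by (simp add: dec_def linear_scale[OF L] scaleR_add_right scaleR_sum_right)

lemma L_dec: "L v = dec v (\<lambda>_. 0)"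
  by (simp add: dec_def)

lemma J_L_dec: "v \<in> T \<Longrightarrow> J (L v) = dec (P v) (\<lambda>\<alpha>. u \<alpha> v)"
  by (simp add: dec_def J_L)

lemma J_\<nu>_dec: "\<alpha> \<in> {1..r} \<Longrightarrow> J (\<nu> \<alpha>) = dec (\<epsilon> *\<^sub>R \<xi> \<alpha>) (a \<alpha>)"
  by (simp add: dec_def J_\<nu> linear_scale[OF L])

text \<open>\<open>J\<close> as a block operator on pairs of a tangent vector and normal
  coefficients. Exchanging the double sum collects the coefficient of each
  \<open>\<nu> \<beta>\<close>.\<close>

lemma J_dec:
  assumes v: "v \<in> T"
  shows "J (dec v c) = dec (P v + \<epsilon> *\<^sub>R (\<Sum>\<alpha>=1..r. c \<alpha> *\<^sub>R \<xi> \<alpha>))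
    (\<lambda>\<beta>. u \<beta> v + (\<Sum>\<alpha>=1..r. c \<alpha> * a \<alpha> \<beta>))"
proof -
  have "J (dec v c) = J (L v) + (\<Sum>\<alpha>=1..r. c \<alpha> *\<^sub>R J (\<nu> \<alpha>))"
    using J_linear L_V[OF v] normal_part_V[of c] linear_within_normal_part[OF J_linear, of c]
    by (simp add: dec_def linear_within_def)
  also have "(\<Sum>\<alpha>=1..r. c \<alpha> *\<^sub>R J (\<nu> \<alpha>)) = \<epsilon> *\<^sub>R L (\<Sum>\<alpha>=1..r. c \<alpha> *\<^sub>R \<xi> \<alpha>) +
      (\<Sum>\<alpha>=1..r. \<Sum>\<beta>=1..r. (c \<alpha> * a \<alpha> \<beta>) *\<^sub>R \<nu> \<beta>)"
    by (simp add: J_\<nu> linear_sum[OF L] linear_scale[OF L] scaleR_add_right scaleR_sum_right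
        sum.distrib mult.commute)
  also have "(\<Sum>\<alpha>=1..r. \<Sum>\<beta>=1..r. (c \<alpha> * a \<alpha> \<beta>) *\<^sub>R \<nu> \<beta>) =
      (\<Sum>\<beta>=1..r. (\<Sum>\<alpha>=1..r. c \<alpha> * a \<alpha> \<beta>) *\<^sub>R \<nu> \<beta>)"
    unfolding scaleR_sum_left by (rule sum.swap)
  finally show ?thesis
    by (simp add: J_L[OF v] dec_def linear_add[OF L] linear_scale[OF L] scaleR_add_left sum.distrib)
qed

lemma sum_\<xi>_T: "(\<Sum>\<alpha>=1..r. c \<alpha> *\<^sub>R \<xi> \<alpha>) \<in> T"
  by (intro subspace_sum[OF T] subspace_scale[OF T] \<xi>_T)

text \<open>Applying the isometry to the pair \<open>J x\<close>, \<open>y\<close> produces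
  \<open>J (J x)\<close>, which is \<open>\<epsilon>\<close> times \<open>x\<close>. So
  \<open>J\<close> is self-adjoint for \<open>\<epsilon>\<close> = 1 and skew-adjoint for
  \<open>\<epsilon>\<close> = -1.\<close>

lemma G_J_left:
  assumes x: "x \<in> V" and y: "y \<in> V"
  shows "G (J x) y = \<epsilon> * G x (J y)"
proof -
  have "G (J x) y = G (J (J x)) (J y)" using G_J_J J_V x y by simp
  also have "\<dots> = G (J y) (\<epsilon> *\<^sub>R x)"
    using J_J[OF x] G_sym J_V[OF y] subspace_scale[OF V x] by simp
  also have "\<dots> = \<epsilon> * G x (J y)" using G_scale G_sym J_V x y by simp
  finally show ?thesis .
qed

section \<open>The eight identities at a point\<close>

lemma P_square_and_u_P:
  assumes v: "v \<in> T"
  shows "P (P v) = \<epsilon> *\<^sub>R (v - (\<Sum>\<alpha>=1..r. u \<alpha> v *\<^sub>R \<xi> \<alpha>))"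
    and "\<alpha> \<in> {1..r} \<Longrightarrow> u \<alpha> (P v) = - (\<Sum>\<beta>=1..r. a \<beta> \<alpha> * u \<beta> v)"
proof -
  have "dec (P (P v) + \<epsilon> *\<^sub>R (\<Sum>\<alpha>=1..r. u \<alpha> v *\<^sub>R \<xi> \<alpha>))
      (\<lambda>\<beta>. u \<beta> (P v) + (\<Sum>\<alpha>=1..r. u \<alpha> v * a \<alpha> \<beta>)) = J (J (L v))"
    by (simp add: J_L_dec[OF v] J_dec[OF P_T[OF v]])
  \<comment> \<open>The vanishing normal coefficients appear as \<open>\<epsilon> * 0\<close>
    because \<open>scaleR_dec\<close> multiplies the zeros coming from \<open>L_dec\<close>.\<close>
  also have "\<dots> = dec (\<epsilon> *\<^sub>R v) (\<lambda>_. \<epsilon> * 0)"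
    unfolding J_J[OF L_V[OF v]] by (simp only: L_dec scaleR_dec)
  finally have eq: "dec (P (P v) + \<epsilon> *\<^sub>R (\<Sum>\<alpha>=1..r. u \<alpha> v *\<^sub>R \<xi> \<alpha>))
      (\<lambda>\<beta>. u \<beta> (P v) + (\<Sum>\<alpha>=1..r. u \<alpha> v * a \<alpha> \<beta>)) = dec (\<epsilon> *\<^sub>R v) (\<lambda>_. \<epsilon> * 0)" .
  have mem: "P (P v) + \<epsilon> *\<^sub>R (\<Sum>\<alpha>=1..r. u \<alpha> v *\<^sub>R \<xi> \<alpha>) \<in> T" "\<epsilon> *\<^sub>R v \<in> T"
    by (intro subspace_add[OF T] subspace_scale[OF T] P_T sum_\<xi>_T v)+
  show "P (P v) = \<epsilon> *\<^sub>R (v - (\<Sum>\<alpha>=1..r. u \<alpha> v *\<^sub>R \<xi> \<alpha>))"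
    using dec_eqD(1)[OF eq mem] by (simp add: scaleR_diff_right eq_diff_eq)
  show "u \<alpha> (P v) = - (\<Sum>\<beta>=1..r. a \<beta> \<alpha> * u \<beta> v)" if "\<alpha> \<in> {1..r}"
    using dec_eqD(2)[OF eq mem that] by (simp add: mult.commute eq_neg_iff_add_eq_0)
qed

lemma P_\<xi>:
  assumes \<alpha>: "\<alpha> \<in> {1..r}"
  shows "P (\<xi> \<alpha>) = - (\<Sum>\<beta>=1..r. a \<alpha> \<beta> *\<^sub>R \<xi> \<beta>)"
proof -
  have \<xi>: "\<epsilon> *\<^sub>R \<xi> \<alpha> \<in> T" by (intro subspace_scale[OF T] \<xi>_T \<alpha>)
  \<comment> \<open>A frame vector has tangent part 0 and a unit coefficient vector. Hence the
    tangent part of \<open>J (J (\<nu> \<alpha>))\<close> vanishes, and the factor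
    \<open>\<epsilon>\<close> in it can be cancelled.\<close>
  have \<nu>: "\<nu> \<alpha> = dec 0 (\<lambda>\<beta>. if \<alpha> = \<beta> then 1 else 0)"
    using \<alpha> by (simp add: dec_def linear_0[OF L] if_distrib[of "\<lambda>x. x *\<^sub>R _"] cong: if_cong)
  have "dec (P (\<epsilon> *\<^sub>R \<xi> \<alpha>) + \<epsilon> *\<^sub>R (\<Sum>\<beta>=1..r. a \<alpha> \<beta> *\<^sub>R \<xi> \<beta>))
      (\<lambda>\<beta>. u \<beta> (\<epsilon> *\<^sub>R \<xi> \<alpha>) + (\<Sum>\<gamma>=1..r. a \<alpha> \<gamma> * a \<gamma> \<beta>)) = J (J (\<nu> \<alpha>))"
    by (simp add: J_\<nu>_dec[OF \<alpha>] J_dec[OF \<xi>])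
  also have "\<dots> = dec (\<epsilon> *\<^sub>R 0) (\<lambda>\<beta>. \<epsilon> * (if \<alpha> = \<beta> then 1 else 0))"
    by (simp only: J_J[OF \<nu>_V[OF \<alpha>]]) (simp only: \<nu> scaleR_dec)
  finally have "P (\<epsilon> *\<^sub>R \<xi> \<alpha>) + \<epsilon> *\<^sub>R (\<Sum>\<beta>=1..r. a \<alpha> \<beta> *\<^sub>R \<xi> \<beta>) = \<epsilon> *\<^sub>R 0"
    by (rule dec_eqD(1)) (intro subspace_add[OF T] subspace_scale[OF T] P_T \<xi> sum_\<xi>_T subspace_0[OF T])+
  then have "\<epsilon> *\<^sub>R (P (\<xi> \<alpha>) + (\<Sum>\<beta>=1..r. a \<alpha> \<beta> *\<^sub>R \<xi> \<beta>)) = 0"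
    using P_linear \<xi>_T[OF \<alpha>] by (simp add: linear_within_def scaleR_add_right)
  moreover have "\<epsilon> \<noteq> 0" using eps by auto
  ultimately show ?thesis by (simp add: eq_neg_iff_add_eq_0)
qed

text \<open>\<open>a\<close> is the matrix of the normal part of \<open>J\<close> on the orthonormal
  frame, so (skew-)adjointness of \<open>J\<close> becomes (skew-)symmetry of
  \<open>a\<close>.\<close>

lemma a_transpose:
  assumes \<alpha>: "\<alpha> \<in> {1..r}" and \<beta>: "\<beta> \<in> {1..r}"
  shows "a \<alpha> \<beta> = \<epsilon> * a \<beta> \<alpha>"
proof -
  have J\<nu>: "G (J (\<nu> \<alpha>)) (\<nu> \<beta>) = a \<alpha> \<beta>" if "\<alpha> \<in> {1..r}" "\<beta> \<in> {1..r}" for \<alpha> \<beta>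
    unfolding J_\<nu>_dec[OF that(1)]
    by (intro G_dec_\<nu> that subspace_scale[OF T] \<xi>_T)
  have "G (J (\<nu> \<alpha>)) (\<nu> \<beta>) = \<epsilon> * G (J (\<nu> \<beta>)) (\<nu> \<alpha>)"
    using G_J_left[OF \<nu>_V[OF \<alpha>] \<nu>_V[OF \<beta>]] G_sym[OF \<nu>_V[OF \<alpha>] J_V[OF \<nu>_V[OF \<beta>]]] by simp
  then show ?thesis unfolding J\<nu>[OF \<alpha> \<beta>] J\<nu>[OF \<beta> \<alpha>] .
qed

text \<open>\<open>u \<alpha> v\<close> is the pairing of \<open>J (L v)\<close> with
  \<open>\<nu> \<alpha>\<close>. Moving \<open>J\<close> across gives one factor
  \<open>\<epsilon>\<close>, and the tangent part \<open>\<epsilon> \<xi>\<close> of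
  \<open>J (\<nu> \<alpha>)\<close> gives another; they cancel.\<close>

lemma u_eq_G_L_\<xi>:
  assumes v: "v \<in> T" and \<alpha>: "\<alpha> \<in> {1..r}"
  shows "u \<alpha> v = G (L v) (L (\<xi> \<alpha>))"
proof -
  have "u \<alpha> v = G (J (L v)) (\<nu> \<alpha>)"
    by (simp add: J_L_dec[OF v] G_dec_\<nu>[OF P_T[OF v] \<alpha>])
  also have "\<dots> = \<epsilon> * G (dec v (\<lambda>_. 0)) (dec (\<epsilon> *\<^sub>R \<xi> \<alpha>) (a \<alpha>))"
    by (simp only: G_J_left[OF L_V[OF v] \<nu>_V[OF \<alpha>]] J_\<nu>_dec[OF \<alpha>] L_dec[symmetric])
  also have "\<dots> = \<epsilon> * G (L v) (\<epsilon> *\<^sub>R L (\<xi> \<alpha>))"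
    by (simp add: G_dec_dec[OF v subspace_scale[OF T \<xi>_T[OF \<alpha>]]] linear_scale[OF L])
  also have "\<dots> = G (L v) (L (\<xi> \<alpha>))"
    by (simp add: G_scale[OF L_V[OF v] L_V[OF \<xi>_T[OF \<alpha>]]] mult.assoc[symmetric] eps)
  finally show ?thesis .
qed

text \<open>Evaluate the isometry on two frame vectors. The tangent parts contribute the wanted
  product times \<open>\<epsilon> * \<epsilon>\<close>, the normal parts the product of
  \<open>a\<close> with its transpose, which \<open>a_transpose\<close> rewrites as
  \<open>\<epsilon>\<close> times the square of \<open>a\<close>.\<close>

lemma G_\<xi>_\<xi>:
  assumes \<alpha>: "\<alpha> \<in> {1..r}" and \<beta>: "\<beta> \<in> {1..r}"
  shows "G (L (\<xi> \<alpha>)) (L (\<xi> \<beta>)) = (if \<alpha> = \<beta> then 1 else 0) - \<epsilon> * (\<Sum>\<gamma>=1..r. a \<alpha> \<gamma> * a \<gamma> \<beta>)"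
proof -
  note \<xi>\<alpha> = \<xi>_T[OF \<alpha>] and \<xi>\<beta> = \<xi>_T[OF \<beta>]
  have "(if \<alpha> = \<beta> then 1 else 0) = G (J (\<nu> \<alpha>)) (J (\<nu> \<beta>))"
    using G_J_J \<nu>_V G_\<nu>_\<nu> \<alpha> \<beta> by simp
  also have "\<dots> = G (\<epsilon> *\<^sub>R L (\<xi> \<alpha>)) (\<epsilon> *\<^sub>R L (\<xi> \<beta>)) + (\<Sum>\<gamma>=1..r. a \<alpha> \<gamma> * a \<beta> \<gamma>)"
    unfolding J_\<nu>_dec[OF \<alpha>] J_\<nu>_dec[OF \<beta>]
    using \<xi>\<alpha> \<xi>\<beta> by (simp add: G_dec_dec subspace_scale[OF T] linear_scale[OF L])
  also have "G (\<epsilon> *\<^sub>R L (\<xi> \<alpha>)) (\<epsilon> *\<^sub>R L (\<xi> \<beta>)) = \<epsilon> * G (L (\<xi> \<beta>)) (\<epsilon> *\<^sub>R L (\<xi> \<alpha>))"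
    using G_scale G_sym L_V[OF \<xi>\<alpha>] L_V[OF \<xi>\<beta>] subspace_scale[OF V] by simp
  also have "\<dots> = G (L (\<xi> \<alpha>)) (L (\<xi> \<beta>))"
    using G_scale[OF L_V[OF \<xi>\<beta>] L_V[OF \<xi>\<alpha>]] G_sym[OF L_V[OF \<xi>\<beta>] L_V[OF \<xi>\<alpha>]] eps
    by (simp add: mult.assoc[symmetric])
  also have "(\<Sum>\<gamma>=1..r. a \<alpha> \<gamma> * a \<beta> \<gamma>) = \<epsilon> * (\<Sum>\<gamma>=1..r. a \<alpha> \<gamma> * a \<gamma> \<beta>)"
    unfolding sum_distrib_left by (rule sum.cong) (use a_transpose[OF \<beta>] in \<open>auto simp: mult.left_commute\<close>)
  finally show ?thesis by simp
qed

text \<open>Both sides of the adjointness of \<open>J\<close> pair a vector with one in the image of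
  \<open>L\<close>, whose normal coefficients are 0; only the tangent parts survive.\<close>

lemma G_P_left:
  assumes v: "v \<in> T" and w: "w \<in> T"
  shows "G (L (P v)) (L w) = \<epsilon> * G (L v) (L (P w))"
proof -
  have "G (J (L v)) (L w) = \<epsilon> * G (L v) (J (L w))"
    by (rule G_J_left[OF L_V[OF v] L_V[OF w]])
  then have "G (dec (P v) (\<lambda>\<alpha>. u \<alpha> v)) (dec w (\<lambda>_. 0)) =
      \<epsilon> * G (dec v (\<lambda>_. 0)) (dec (P w) (\<lambda>\<alpha>. u \<alpha> w))"
    by (simp only: J_L_dec[OF v] J_L_dec[OF w] L_dec[symmetric])
  then show ?thesis by (simp add: G_dec_dec P_T v w)
qed

text \<open>Here both arguments of the isometry have normal parts, and these account for the extra
  sum.\<close>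

lemma G_P_P:
  assumes v: "v \<in> T" and w: "w \<in> T"
  shows "G (L (P v)) (L (P w)) = G (L v) (L w) - (\<Sum>\<alpha>=1..r. u \<alpha> v * u \<alpha> w)"
  using G_J_J[OF L_V[OF v] L_V[OF w]] by (simp add: J_L_dec v w G_dec_dec P_T)

end

section \<open>From identities at a point to identities of fields\<close>

theorem theorem1p1:
  fixes M :: "('p, 'e::euclidean_space) manifold"
    and Mt :: "('q, 'f::euclidean_space) manifold"
    and \<iota> :: "'p \<Rightarrow> 'q"
    and gt :: "'q \<Rightarrow> ('q, 'f) tvec \<Rightarrow> ('q, 'f) tvec \<Rightarrow> real"
    and Pt :: "'q \<Rightarrow> ('q, 'f) tvec \<Rightarrow> ('q, 'f) tvec"
    and g :: "'p \<Rightarrow> ('p, 'e) tvec \<Rightarrow> ('p, 'e) tvec \<Rightarrow> real"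
    and N :: "nat \<Rightarrow> 'p \<Rightarrow> ('q, 'f) tvec"
    and P :: "'p \<Rightarrow> ('p, 'e) tvec \<Rightarrow> ('p, 'e) tvec"
    and u :: "nat \<Rightarrow> 'p \<Rightarrow> ('p, 'e) tvec \<Rightarrow> real"
    and \<xi> :: "nat \<Rightarrow> 'p \<Rightarrow> ('p, 'e) tvec"
    and a :: "nat \<Rightarrow> nat \<Rightarrow> 'p \<Rightarrow> real"
    and \<epsilon> :: real and n r :: nat
  assumes "\<epsilon> \<in> {1, -1}"
    and "smooth_manifold Mt" and "riemannian_metric Mt gt"
    and "tensor_field_11 Mt Pt"
    and "\<forall>q\<in>points Mt. \<forall>v\<in>tangent_space Mt q. Pt q (Pt q v) = \<epsilon> *\<^sub>R v"
    and "\<forall>U\<in>vector_fields Mt. \<forall>V\<in>vector_fields Mt. \<forall>q\<in>points Mt.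
           gt q (Pt q (U q)) (Pt q (V q)) = gt q (U q) (V q)"
    and "smooth_manifold M" and "immersion M Mt \<iota>"
    and "DIM('e) = n" and "DIM('f) = n + r"
    and "g = induced_metric M Mt \<iota> gt"
    and "normal_frame M Mt \<iota> gt r N"
    and "induced_structure M Mt \<iota> Pt \<epsilon> r N P u \<xi> a"
  shows "(\<forall>X\<in>vector_fields M. \<forall>p\<in>points M.
            P p (P p (X p)) = \<epsilon> *\<^sub>R (X p - (\<Sum>\<alpha>=1..r. u \<alpha> p (X p) *\<^sub>R \<xi> \<alpha> p))) \<and>
         (\<forall>X\<in>vector_fields M. \<forall>\<alpha>\<in>{1..r}. \<forall>p\<in>points M.
            u \<alpha> p (P p (X p)) = - (\<Sum>\<beta>=1..r. a \<beta> \<alpha> p * u \<beta> p (X p))) \<and>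
         (\<forall>\<alpha>\<in>{1..r}. \<forall>\<beta>\<in>{1..r}. \<forall>p\<in>points M. a \<alpha> \<beta> p = \<epsilon> * a \<beta> \<alpha> p) \<and>
         (\<forall>\<alpha>\<in>{1..r}. \<forall>\<beta>\<in>{1..r}. \<forall>p\<in>points M.
            u \<alpha> p (\<xi> \<beta> p) = g p (\<xi> \<alpha> p) (\<xi> \<beta> p) \<and>
            g p (\<xi> \<alpha> p) (\<xi> \<beta> p) =
              (if \<alpha> = \<beta> then 1 else 0) - \<epsilon> * (\<Sum>\<gamma>=1..r. a \<alpha> \<gamma> p * a \<gamma> \<beta> p)) \<and>
         (\<forall>\<alpha>\<in>{1..r}. \<forall>p\<in>points M.
            P p (\<xi> \<alpha> p) = - (\<Sum>\<beta>=1..r. a \<alpha> \<beta> p *\<^sub>R \<xi> \<beta> p)) \<and>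
         (\<forall>X\<in>vector_fields M. \<forall>\<alpha>\<in>{1..r}. \<forall>p\<in>points M. u \<alpha> p (X p) = g p (X p) (\<xi> \<alpha> p)) \<and>
         (\<forall>X\<in>vector_fields M. \<forall>Y\<in>vector_fields M. \<forall>p\<in>points M.
            g p (P p (X p)) (Y p) = \<epsilon> * g p (X p) (P p (Y p))) \<and>
         (\<forall>X\<in>vector_fields M. \<forall>Y\<in>vector_fields M. \<forall>p\<in>points M.
            g p (P p (X p)) (P p (Y p)) =
              g p (X p) (Y p) - (\<Sum>\<alpha>=1..r. u \<alpha> p (X p) * u \<alpha> p (Y p)))"
proof -
  have M: "smooth_manifold M" and Mt: "smooth_manifold Mt" and \<iota>: "smooth_map M Mt \<iota>"
    using assms(2,7,8) by (auto simp: immersion_def)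
  note ind = assms(13)[unfolded induced_structure_def]
  have dec: "induced_decomposition (tangent_space M p) (tangent_space Mt (\<iota> p))
      (differential M Mt \<iota> p) (gt (\<iota> p)) (Pt (\<iota> p)) \<epsilon> r (\<lambda>\<alpha>. N \<alpha> p)
      (P p) (\<lambda>\<alpha>. u \<alpha> p) (\<lambda>\<alpha>. \<xi> \<alpha> p) (\<lambda>\<alpha> \<beta>. a \<alpha> \<beta> p)"
    if p: "p \<in> points M" for p
  proof (rule induced_decomposition.intro)
    have q: "\<iota> p \<in> points Mt"
      using \<iota> p by (auto simp: smooth_map_def continuous_map_def)
    have normal: "N \<alpha> p \<in> normal_space M Mt \<iota> gt p" if "\<alpha> \<in> {1..r}" for \<alpha>
      using assms(12) p that span_base[of "N \<alpha> p" "(\<lambda>\<alpha>. N \<alpha> p) ` {1..r}"]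
      unfolding normal_frame_def by blast
    show "\<epsilon> * \<epsilon> = 1" using assms(1) by auto
    show "subspace (tangent_space M p)" "subspace (tangent_space Mt (\<iota> p))"
      by (rule subspace_tangent_space, fact)+
    show "linear (differential M Mt \<iota> p)"
      by (rule linear_differential[OF M Mt \<iota> p])
    show "differential M Mt \<iota> p v \<in> tangent_space Mt (\<iota> p)" for v
      by (rule differential_in_tangent_space[OF M Mt \<iota> p])
    show "inj_on (differential M Mt \<iota> p) (tangent_space M p)"
      using assms(8) p unfolding immersion_def by blast
    show "linear_within (tangent_space Mt (\<iota> p)) (gt (\<iota> p) x)"
      if "x \<in> tangent_space Mt (\<iota> p)" for x
      using assms(3) q that unfolding riemannian_metric_def by blast
    show "gt (\<iota> p) x y = gt (\<iota> p) y x"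
      if "x \<in> tangent_space Mt (\<iota> p)" "y \<in> tangent_space Mt (\<iota> p)" for x y
      using assms(3) q that unfolding riemannian_metric_def by blast
    show "Pt (\<iota> p) x \<in> tangent_space Mt (\<iota> p)" if "x \<in> tangent_space Mt (\<iota> p)" for x
      using assms(4) q that unfolding tensor_field_11_def by blast
    show "linear_within (tangent_space Mt (\<iota> p)) (Pt (\<iota> p))"
      using assms(4) q unfolding tensor_field_11_def by blast
    show "Pt (\<iota> p) (Pt (\<iota> p) x) = \<epsilon> *\<^sub>R x" if "x \<in> tangent_space Mt (\<iota> p)" for x
      using assms(5) q that by blast
    show "gt (\<iota> p) (Pt (\<iota> p) x) (Pt (\<iota> p) y) = gt (\<iota> p) x y"
      if x: "x \<in> tangent_space Mt (\<iota> p)" and y: "y \<in> tangent_space Mt (\<iota> p)" for x y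
    proof -
      \<comment> \<open>The isometry is assumed for vector fields on the ambient manifold, so both
        vectors are extended.\<close>
      obtain X Y where "X \<in> vector_fields Mt" "X (\<iota> p) = x" "Y \<in> vector_fields Mt" "Y (\<iota> p) = y"
        using tangent_vector_extends[OF Mt q x] tangent_vector_extends[OF Mt q y] by metis
      then show ?thesis using assms(6) q by blast
    qed
    show "N \<alpha> p \<in> tangent_space Mt (\<iota> p)" if "\<alpha> \<in> {1..r}" for \<alpha>
      using normal[OF that] unfolding normal_space_def by blast
    show "gt (\<iota> p) (differential M Mt \<iota> p v) (N \<alpha> p) = 0"
      if "v \<in> tangent_space M p" "\<alpha> \<in> {1..r}" for v \<alpha>
      using normal[OF that(2)] that(1) unfolding normal_space_def by blast
    show "gt (\<iota> p) (N \<alpha> p) (N \<beta> p) = (if \<alpha> = \<beta> then 1 else 0)"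
      if "\<alpha> \<in> {1..r}" "\<beta> \<in> {1..r}" for \<alpha> \<beta>
      using assms(12) p that unfolding normal_frame_def by blast
    show "P p v \<in> tangent_space M p" if "v \<in> tangent_space M p" for v
      using ind p that unfolding tensor_field_11_def by blast
    show "linear_within (tangent_space M p) (P p)"
      using ind p unfolding tensor_field_11_def by blast
    show "\<xi> \<alpha> p \<in> tangent_space M p" if "\<alpha> \<in> {1..r}" for \<alpha>
      using ind p that unfolding vector_fields_def by blast
    show "Pt (\<iota> p) (differential M Mt \<iota> p v) =
        differential M Mt \<iota> p (P p v) + (\<Sum>\<alpha>=1..r. u \<alpha> p v *\<^sub>R N \<alpha> p)"
      if v: "v \<in> tangent_space M p" for v
    proof -
      \<comment> \<open>Likewise the decomposition is given for fields on \<open>M\<close> only, but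
        the locale applies it to vectors such as \<open>P p v\<close>.\<close>
      obtain X where "X \<in> vector_fields M" "X p = v"
        by (rule tangent_vector_extends[OF M p v])
      then show ?thesis using ind p by blast
    qed
    show "Pt (\<iota> p) (N \<alpha> p) =
        \<epsilon> *\<^sub>R differential M Mt \<iota> p (\<xi> \<alpha> p) + (\<Sum>\<beta>=1..r. a \<alpha> \<beta> p *\<^sub>R N \<beta> p)"
      if "\<alpha> \<in> {1..r}" for \<alpha>
      using ind p that by blast
  qed
  have X: "X p \<in> tangent_space M p" if "X \<in> vector_fields M" "p \<in> points M" for X p
    using that unfolding vector_fields_def by blast
  show ?thesis
    unfolding assms(11) induced_metric_def
  proof (intro conjI ballI)
    \<comment> \<open>Only this conjunct is not a direct instance of a lemma of the locale:
      \<open>u_eq_G_L_\<xi>\<close> yields the product with its arguments in the opposite order, so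
      symmetry of the metric is used.\<close>
    fix \<alpha> \<beta> p assume \<alpha>: "\<alpha> \<in> {1..r}" and \<beta>: "\<beta> \<in> {1..r}" and p: "p \<in> points M"
    interpret induced_decomposition "tangent_space M p" "tangent_space Mt (\<iota> p)"
      "differential M Mt \<iota> p" "gt (\<iota> p)" "Pt (\<iota> p)" \<epsilon> r "\<lambda>\<alpha>. N \<alpha> p"
      "P p" "\<lambda>\<alpha>. u \<alpha> p" "\<lambda>\<alpha>. \<xi> \<alpha> p" "\<lambda>\<alpha> \<beta>. a \<alpha> \<beta> p"
      by (rule dec[OF p])
    show "u \<alpha> p (\<xi> \<beta> p) =
        gt (\<iota> p) (differential M Mt \<iota> p (\<xi> \<alpha> p)) (differential M Mt \<iota> p (\<xi> \<beta> p))"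
      using u_eq_G_L_\<xi>[OF \<xi>_T[OF \<beta>] \<alpha>] G_sym[OF L_V[OF \<xi>_T[OF \<alpha>]] L_V[OF \<xi>_T[OF \<beta>]]] by simp
  qed ((rule induced_decomposition.P_square_and_u_P[OF dec]
      induced_decomposition.a_transpose[OF dec]
      induced_decomposition.G_\<xi>_\<xi>[OF dec]
      induced_decomposition.P_\<xi>[OF dec]
      induced_decomposition.u_eq_G_L_\<xi>[OF dec]
      induced_decomposition.G_P_left[OF dec]
      induced_decomposition.G_P_P[OF dec]; (assumption | rule X)+)+)
qed

end
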